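(* Let $\beta,\gamma\in[0,2)$ with $\beta+\gamma<2$ and let $n\ge2$ be an integer. Then $$\mathcal{T}^{\beta,\gamma}_{n}=\mathcal{U}^{\beta+\frac{2-\beta-\gamma}{2n},\,\gamma+\frac{2-\beta-\gamma}{2n}}_{n}.$$
   Context: For $\beta,\gamma\in[0,2)$ with $\beta+\gamma<2$, the $(\beta,\gamma)$-Chebyshev points and $(\beta,\gamma)$-Chebyshev-Lobatto points are $$\mathcal{T}^{\beta,\gamma}_n=\Big\{\cos\Big(\frac{(2-\beta-\gamma)(2j-1)\pi}{4n}+\frac{\gamma\pi}{2}\Big)\Big\}_{j=1,\dots,n}\ (n\ge1),\qquad \mathcal{U}^{\beta,\gamma}_{n}=\Big\{\cos\Big(\frac{(2-\beta-\gamma)j\pi}{2(n-1)}+\frac{\gamma\pi}{2}\Big)\Big\}_{j=0,\dots,n-1}\ (n\ge2).$$ *)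

theory Defs
  imports Complex_Main
begin

text \<open>
  The parameters are meant to satisfy \<open>\<beta>, \<gamma> \<in> {0..<2}\<close> and \<open>\<beta> + \<gamma> < 2\<close>, with \<open>n \<ge> 1\<close> for
  the first family and \<open>n \<ge> 2\<close> for the second; outside this range the formulas have no intended
  meaning.
\<close>

definition chebyshev_points :: "real \<Rightarrow> real \<Rightarrow> nat \<Rightarrow> real set" where
  "chebyshev_points \<beta> \<gamma> n =
     (\<lambda>j. cos ((2 - \<beta> - \<gamma>) * (2 * real j - 1) * pi / (4 * real n) + \<gamma> * pi / 2)) ` {1..n}"

definition chebyshev_lobatto_points :: "real \<Rightarrow> real \<Rightarrow> nat \<Rightarrow> real set" where
  "chebyshev_lobatto_points \<beta> \<gamma> n =
     (\<lambda>j. cos ((2 - \<beta> - \<gamma>) * real j * pi / (2 * (real n - 1)) + \<gamma> * pi / 2)) ` {0..n - 1}"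

lemma shifted_parameters_admissible:
  fixes \<beta> \<gamma> :: real and n :: nat
  assumes "\<beta> \<in> {0..<2}" and "\<gamma> \<in> {0..<2}" and "\<beta> + \<gamma> < 2" and "n \<ge> 2"
  defines "d \<equiv> (2 - \<beta> - \<gamma>) / (2 * real n)"
  shows "\<beta> + d \<in> {0..<2}" and "\<gamma> + d \<in> {0..<2}" and "(\<beta> + d) + (\<gamma> + d) < 2"
proof -
  have d: "d > 0"
    unfolding d_def using assms by simp
  have "2 * d * real n = 2 - \<beta> - \<gamma>"
    unfolding d_def using assms by simp
  moreover have "2 * d * 2 \<le> 2 * d * real n"
    using d assms by (intro mult_left_mono) auto
  ultimately have "4 * d \<le> 2 - \<beta> - \<gamma>"
    by linarith
  then show "\<beta> + d \<in> {0..<2}" "\<gamma> + d \<in> {0..<2}" "(\<beta> + d) + (\<gamma> + d) < 2"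
    using d assms(1-3) unfolding atLeastLessThan_iff by linarith+
qed

end

theory Submission
  imports Defs
begin

text \<open>Both families are cosines of angles in arithmetic progression. With
  \<open>L = 2 - \<beta> - \<gamma>\<close> and \<open>d = L / (2 * n)\<close>, the Chebyshev angles
  start at \<open>(\<gamma> + d) * pi / 2\<close> and increase by \<open>d * pi\<close>. Moving both
  parameters by \<open>d\<close> gives the Lobatto angles exactly this start and this increment, so
  the sets agree angle by angle, without any identity for the cosine.\<close>

theorem proposition6:
  fixes \<beta> \<gamma> :: real and n :: nat
  assumes "\<beta> \<in> {0..<2}" and "\<gamma> \<in> {0..<2}" and "\<beta> + \<gamma> < 2" and "n \<ge> 2"
  shows "chebyshev_points \<beta> \<gamma> n =
         chebyshev_lobatto_points
           (\<beta> + (2 - \<beta> - \<gamma>) / (2 * real n)) (\<gamma> + (2 - \<beta> - \<gamma>) / (2 * real n)) n"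
proof -
  define L where "L = 2 - \<beta> - \<gamma>"
  define d where "d = L / (2 * real n)"
  have n: "real n > 0" "real n - 1 > 0"
    using assms(4) by auto
  have L: "L = 2 * d * real n"
    unfolding d_def using n by simp
  \<comment> \<open>The factor \<open>real n - 1\<close> cancels the Lobatto denominator and leaves
    the increment \<open>d * pi\<close>.\<close>
  have shifted_length: "2 - (\<beta> + d) - (\<gamma> + d) = 2 * d * (real n - 1)"
    using L unfolding L_def by (simp add: algebra_simps)
  have angle: "L * (2 * real (Suc j) - 1) * pi / (4 * real n) + \<gamma> * pi / 2 =
      (2 - (\<beta> + d) - (\<gamma> + d)) * real j * pi / (2 * (real n - 1)) + (\<gamma> + d) * pi / 2" for j
  proof -
    have "L * (2 * real (Suc j) - 1) * pi / (4 * real n) = d * (2 * real j + 1) * pi / 2"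
      unfolding L using n by (simp add: field_simps)
    moreover have "(2 - (\<beta> + d) - (\<gamma> + d)) * real j * pi / (2 * (real n - 1)) = d * real j * pi"
      unfolding shifted_length using n by (simp add: nonzero_divide_eq_eq del: right_diff_distrib_numeral)
    \<comment> \<open>The two terms differ by \<open>d * pi / 2\<close>, which is the shift of
      \<open>\<gamma>\<close>.\<close>
    ultimately show ?thesis
      by (simp add: field_simps)
  qed
  \<comment> \<open>Chebyshev indices start at 1, Lobatto indices at 0; \<open>n - 1\<close> is
    subtraction on naturals, so \<open>n\<close> must be positive.\<close>
  have "{1..n} = Suc ` {0..n - 1}"
    using assms(4) by (simp add: image_Suc_atLeastAtMost)
  then have "chebyshev_points \<beta> \<gamma> n = chebyshev_lobatto_points (\<beta> + d) (\<gamma> + d) n"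
    unfolding chebyshev_points_def chebyshev_lobatto_points_def L_def [symmetric]
    by (simp only: image_image angle)
  then show ?thesis
    unfolding d_def L_def .
qed

end
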